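(* Let $N\ge 2$, $m\ge 1$, and let $y^{(1)},\dots,y^{(m)},y^{(m+1)}\in\mathbb R^{N-1}\setminus\{0\}$. Let $$P=\{(x,s)\in\mathbb R^{N-1}\times\mathbb R_+ : (y^{(i)}/\|y^{(i)}\|_2)^\top x\le s,\ i=1,\dots,m\},$$ and let $\bar P$ be obtained from $P$ by adding the cut based on $y^{(m+1)}$, i.e. $\bar P=P\cap\{(x,s): (y^{(m+1)}/\|y^{(m+1)}\|_2)^\top x\le s\}$. Let $(\bar x,\bar s)\in\bar P\setminus L^N$. Then $$\Delta(\bar x,\bar s,P)-\Delta(\bar x,\bar s,\bar P)\le \min_{i=1,\dots,m}\|y^{(i)}-y^{(m+1)}\|_2 .$$ Furthermore, letting $\sigma_i\in[0,\pi]$ be the angle between $y^{(m+1)}$ and $y^{(i)}$ for $i=1,\dots,m$, $$\Pi(\bar x,\bar s,P)-\Pi(\bar x,\bar s,\bar P)\le 2\|\bar x\|_2\min_{i=1,\dots,m}\sin\left(\frac{\sigma_i}{2}\right).$$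
   Context: The second-order cone is $L^N=\{(x,s)\in\mathbb R^{N-1}\times\mathbb R_+:\|x\|_2\le s\}$. For a relaxation $Q$ of $L^N$ defined by supporting cuts $(y^{(i)}/\|y^{(i)}\|_2)^\top x\le s$, $i=1,\dots,k$ (so $k=m$ for $P$ and $k=m+1$ for $\bar P$), and a point $(\bar x,\bar s)\in Q\setminus L^N$ (so $\bar x\neq 0$), define $$\Delta(\bar x,\bar s,Q)=\min_{i=1,\dots,k}\|\bar x-y^{(i)}\|_2,\qquad \Pi(\bar x,\bar s,Q)=\|\bar x\|_2\Bigl(1-\max_{i=1,\dots,k}\cos\theta_i\Bigr),$$ where $\theta_i\in[0,\pi]$ is the angle between $\bar x$ and $y^{(i)}$. *)

theory Defs
  imports "HOL-Analysis.Analysis"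
begin

text \<open>
  The ambient space of dimension \<open>N - 1\<close> is \<open>real ^ 'n\<close>, so \<open>N = CARD('n) + 1\<close>, and points of
  dimension \<open>N\<close> are pairs \<open>(x, s)\<close>.
\<close>

definition second_order_cone :: "((real ^ 'n) \<times> real) set" where
  "second_order_cone = {(x, s). 0 \<le> s \<and> norm x \<le> s}"

definition supporting_cut :: "real ^ 'n \<Rightarrow> ((real ^ 'n) \<times> real) set" where
  "supporting_cut v = {(x, s). (v /\<^sub>R norm v) \<bullet> x \<le> s}"

text \<open>
  A relaxation is given by its generators \<open>y 1, \<dots>, y k\<close>; the quantities \<open>\<Delta>\<close> and \<open>\<Pi>\<close> depend on
  these generators and not only on the resulting set of points, so they take \<open>y\<close> and \<open>k\<close> as
  arguments. The values of \<open>y\<close> outside \<open>{1..k}\<close> are irrelevant.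
\<close>

definition relaxation :: "(nat \<Rightarrow> real ^ 'n) \<Rightarrow> nat \<Rightarrow> ((real ^ 'n) \<times> real) set" where
  "relaxation y k = {(x, s). 0 \<le> s \<and> (\<forall>i\<in>{1..k}. (x, s) \<in> supporting_cut (y i))}"

text \<open>The angle in \<open>[0, \<pi>]\<close>; only meaningful for nonzero vectors.\<close>

definition vec_angle :: "real ^ 'n \<Rightarrow> real ^ 'n \<Rightarrow> real" where
  "vec_angle u v = arccos ((u \<bullet> v) / (norm u * norm v))"

text \<open>
  Both quantities are meant for \<open>k \<ge> 1\<close>, nonzero generators and a point of \<open>relaxation y k\<close>
  outside the cone (so that its first component is nonzero). Neither formula involves \<open>s\<close>.
\<close>

definition Delta :: "(real ^ 'n) \<times> real \<Rightarrow> (nat \<Rightarrow> real ^ 'n) \<Rightarrow> nat \<Rightarrow> real" where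
  "Delta = (\<lambda>(x, s) y k. Min ((\<lambda>i. norm (x - y i)) ` {1..k}))"

definition Pi_measure :: "(real ^ 'n) \<times> real \<Rightarrow> (nat \<Rightarrow> real ^ 'n) \<Rightarrow> nat \<Rightarrow> real" where
  "Pi_measure = (\<lambda>(x, s) y k. norm x * (1 - Max ((\<lambda>i. cos (vec_angle x (y i))) ` {1..k})))"

end

theory Submission
  imports Defs
begin

text \<open>
  Both inequalities express that the best generator for a point changes by no more than the
  distance from the new generator to its nearest predecessor. If the new generator does not improve
  the optimum over the old ones, the left-hand side is zero. If it does, it is the unique optimum,
  and replacing it by any old generator \<open>y i\<close> costs a controlled amount, so the old optimum is
  at most that much worse (lemmas \<open>Min_insert_drop_le\<close> and \<open>Max_insert_rise_le\<close>).

  For \<open>\<Delta>\<close> the cost of the replacement is bounded by the triangle inequality. For \<open>\<Pi>\<close> one passes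
  to unit vectors: the cosine of an angle is the inner product of the two directions, so by
  Cauchy-Schwarz the cost is at most \<open>norm xbar\<close> times the length of the chord between the directions of \<open>y i\<close> and
  \<open>y (m + 1)\<close>, and the chord subtending an angle \<open>\<sigma>\<close> of the unit circle has length
  \<open>2 sin (\<sigma> / 2)\<close>.
\<close>

lemma Min_insert_drop_le:
  fixes f g :: "'a \<Rightarrow> real"
  assumes "finite A" "A \<noteq> {}"
    and cost: "\<And>i. i \<in> A \<Longrightarrow> f i \<le> f b + g i"
    and nonneg: "\<And>i. i \<in> A \<Longrightarrow> 0 \<le> g i"
  shows "Min (f ` A) - Min (f ` insert b A) \<le> Min (g ` A)"
proof -
  have "Min (f ` A) - Min (f ` insert b A) \<le> g i" if "i \<in> A" for i
  proof -
    have "Min (f ` A) \<le> f i"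
      using assms(1) that by simp
    moreover have "Min (f ` insert b A) = min (f b) (Min (f ` A))"
      using assms(1,2) by simp
    ultimately show ?thesis
      using cost[OF that] nonneg[OF that] by linarith
  qed
  then show ?thesis
    using assms(1,2) by simp
qed

lemma Max_insert_rise_le:
  fixes f g :: "'a \<Rightarrow> real"
  assumes "finite A" "A \<noteq> {}"
    and cost: "\<And>i. i \<in> A \<Longrightarrow> f b \<le> f i + g i"
    and nonneg: "\<And>i. i \<in> A \<Longrightarrow> 0 \<le> g i"
  shows "Max (f ` insert b A) - Max (f ` A) \<le> Min (g ` A)"
proof -
  have "Max (f ` insert b A) - Max (f ` A) \<le> g i" if "i \<in> A" for i
  proof -
    have "f i \<le> Max (f ` A)"
      using assms(1) that by simp
    moreover have "Max (f ` insert b A) = max (f b) (Max (f ` A))"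
      using assms(1,2) by simp
    ultimately show ?thesis
      using cost[OF that] nonneg[OF that] by linarith
  qed
  then show ?thesis
    using assms(1,2) by simp
qed

text \<open>
  Cauchy-Schwarz places the quotient in the domain of \<open>arccos\<close>. The identity includes zero vectors:
  division by zero makes the quotient zero, in agreement with \<open>sgn 0 = 0\<close>.
\<close>

lemma cos_vec_angle: "cos (vec_angle u v) = sgn u \<bullet> sgn v"
proof -
  have eq: "(u \<bullet> v) / (norm u * norm v) = sgn u \<bullet> sgn v"
    by (simp add: sgn_div_norm divide_simps)
  have "\<bar>sgn u \<bullet> sgn v\<bar> \<le> norm (sgn u) * norm (sgn v)"
    by (rule Cauchy_Schwarz_ineq2)
  also have "\<dots> \<le> 1"
    by (simp add: norm_sgn)
  finally show ?thesis
    unfolding vec_angle_def eq by (rule cos_arccos_abs)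
qed

lemma vec_angle_bounds: "0 \<le> vec_angle u v" "vec_angle u v \<le> pi"
proof -
  have "\<bar>(u \<bullet> v) / (norm u * norm v)\<bar> \<le> 1"
    using Cauchy_Schwarz_ineq2[of u v] by (auto simp: abs_mult divide_le_eq_1)
  then show "0 \<le> vec_angle u v" "vec_angle u v \<le> pi"
    unfolding vec_angle_def abs_le_iff by (auto intro: arccos_lbound arccos_ubound)
qed

lemma sin_half_vec_angle_nonneg: "0 \<le> sin (vec_angle u v / 2)"
  using vec_angle_bounds[of u v] by (intro sin_ge_zero) auto

text \<open>
  The squares of both sides equal \<open>2 - 2 cos \<sigma>\<close>: on the left by expanding the inner product of
  unit vectors, on the right by the half-angle formula.
\<close>

lemma norm_sgn_diff_eq_chord:
  assumes "u \<noteq> 0" "v \<noteq> 0"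
  shows "norm (sgn u - sgn v) = 2 * sin (vec_angle u v / 2)"
proof (rule power2_eq_imp_eq)
  have "(norm (sgn u - sgn v))\<^sup>2 = 2 - 2 * (sgn u \<bullet> sgn v)"
    using dot_norm_neg[of "sgn u" "sgn v"] assms by (simp add: norm_sgn)
  also have "\<dots> = 2 - 2 * cos (2 * (vec_angle u v / 2))"
    by (simp add: cos_vec_angle)
  also have "\<dots> = (2 * sin (vec_angle u v / 2))\<^sup>2"
    unfolding cos_double_sin by (simp add: power_mult_distrib)
  finally show "(norm (sgn u - sgn v))\<^sup>2 = (2 * sin (vec_angle u v / 2))\<^sup>2" .
qed (use sin_half_vec_angle_nonneg[of u v] in auto)

lemma cos_vec_angle_diff_le_chord:
  assumes "u \<noteq> 0" "v \<noteq> 0"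
  shows "cos (vec_angle x u) - cos (vec_angle x v) \<le> 2 * sin (vec_angle u v / 2)"
proof -
  have "cos (vec_angle x u) - cos (vec_angle x v) = sgn x \<bullet> (sgn u - sgn v)"
    by (simp add: cos_vec_angle inner_diff_right)
  also have "\<dots> \<le> norm (sgn x) * norm (sgn u - sgn v)"
    by (rule norm_cauchy_schwarz)
  also have "\<dots> \<le> norm (sgn u - sgn v)"
    by (simp add: norm_sgn)
  finally show ?thesis
    using norm_sgn_diff_eq_chord[OF assms] by simp
qed

theorem theorem2p3:
  fixes y :: "nat \<Rightarrow> real ^ 'n" and m :: nat
    and xbar :: "real ^ 'n" and sbar :: real
  assumes "m \<ge> 1"
    and "\<And>i. i \<in> {1..m + 1} \<Longrightarrow> y i \<noteq> 0"
    and "(xbar, sbar) \<in> (relaxation y m \<inter> supporting_cut (y (m + 1))) - second_order_cone"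
  shows "Delta (xbar, sbar) y m - Delta (xbar, sbar) y (m + 1)
           \<le> Min ((\<lambda>i. norm (y i - y (m + 1))) ` {1..m})
       \<and> Pi_measure (xbar, sbar) y m - Pi_measure (xbar, sbar) y (m + 1)
           \<le> 2 * norm xbar * Min ((\<lambda>i. sin (vec_angle (y (m + 1)) (y i) / 2)) ` {1..m})"
proof
  have ins: "{1..m + 1} = insert (m + 1) {1..m}"
    by auto
  have A: "finite {1..m}" "{1..m} \<noteq> {}"
    using assms(1) by auto
  show "Delta (xbar, sbar) y m - Delta (xbar, sbar) y (m + 1)
          \<le> Min ((\<lambda>i. norm (y i - y (m + 1))) ` {1..m})"
    unfolding Delta_def prod.case ins
  proof (rule Min_insert_drop_le[OF A])
    show "norm (xbar - y i) \<le> norm (xbar - y (m + 1)) + norm (y i - y (m + 1))" for i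
      using norm_triangle_ineq4[of "xbar - y (m + 1)" "y i - y (m + 1)"] by simp
  qed simp
  let ?c = "\<lambda>i. cos (vec_angle xbar (y i))"
  let ?s = "\<lambda>i. sin (vec_angle (y (m + 1)) (y i) / 2)"
  have "Max (?c ` insert (m + 1) {1..m}) - Max (?c ` {1..m}) \<le> Min ((\<lambda>i. 2 * ?s i) ` {1..m})"
  proof (rule Max_insert_rise_le[OF A])
    fix i assume "i \<in> {1..m}"
    then show "?c (m + 1) \<le> ?c i + 2 * ?s i"
      using cos_vec_angle_diff_le_chord[of "y (m + 1)" "y i" xbar] assms(2) by simp
    show "0 \<le> 2 * ?s i"
      using sin_half_vec_angle_nonneg by simp
  qed
  also have "\<dots> = 2 * Min (?s ` {1..m})"
    using mono_Min_commute[of "\<lambda>t::real. 2 * t" "?s ` {1..m}"] A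
    by (simp add: image_image mono_def)
  finally have "norm xbar * (Max (?c ` {1..m + 1}) - Max (?c ` {1..m}))
                  \<le> norm xbar * (2 * Min (?s ` {1..m}))"
    unfolding ins by (rule mult_left_mono) simp
  then show "Pi_measure (xbar, sbar) y m - Pi_measure (xbar, sbar) y (m + 1)
               \<le> 2 * norm xbar * Min (?s ` {1..m})"
    by (simp add: Pi_measure_def algebra_simps)
qed

end
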